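(* Let $k$ be a positive integer. Every indecomposable matching with at least $(2k)^{2k}$ edges contains a broken nesting, an interleaving, or a proper pin sequence with $k$ edges.
   Context: A (labeled, complete) matching is a graph on the vertex set $[2n]=\{1,\dots,2n\}$ in which every vertex is incident to exactly one edge. An interval of a matching is a contiguous segment $[i,j]=\{i,i+1,\dots,j\}$ of vertices such that no vertex of $[i,j]$ is adjacent to a vertex outside $[i,j]$; the empty set and the whole vertex set are the trivial intervals, and a matching is indecomposable if it has no other intervals. A matching $M$ contains a matching $N$ if $N$ can be obtained from $M$ by deleting a collection of edges together with their endpoints and then relabeling the remaining vertices order-preservingly by $1,2,\dots$. The interleaving on $[2n]$ is the matching with edges $i\sim i+n$ for $i\in[n]$. The right-broken nesting on $[2n]$ has edges $n\sim 2n$ and $i\sim 2n-i$ for $i\in[n-1]$; the left-broken nesting on $[2n]$ has edges $1\sim n+1$ and $i+1\sim 2n-i+1$ for $i\in[n-1]$; a broken nesting is a left- or right-broken nesting. The shadow of a set of edges is the smallest contiguous segment of vertices containing all their endpoints. An edge splits a shadow if exactly one of its endpoints lies in that shadow. A pin sequence is a sequence of edges $p_1,p_2,\dots,p_m$ such that for each $i\ge 2$, $p_i$ splits the shadow of $\{p_1,\dots,p_{i-1}\}$; it is proper if moreover for each $i\ge 3$, $p_i$ does not split the shadow of $\{p_1,\dots,p_{i-2}\}$. A matching with $k$ edges is called a (proper) pin sequence if its $k$ edges can be ordered to form a (proper) pin sequence. *)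

theory Defs
  imports Main
begin

text \<open>A graph on the vertex set \<open>{1..2 * n}\<close> is represented by its set of edges,
  each edge being a two-element set of vertices.\<close>

definition matching :: "nat \<Rightarrow> nat set set \<Rightarrow> bool" where
  "matching n M \<longleftrightarrow>
     (\<forall>e\<in>M. e \<subseteq> {1..2 * n} \<and> card e = 2) \<and>
     (\<forall>v\<in>{1..2 * n}. \<exists>!e. e \<in> M \<and> v \<in> e)"

definition interval_of :: "nat \<Rightarrow> nat set set \<Rightarrow> nat set \<Rightarrow> bool" where
  "interval_of n M I \<longleftrightarrow>
     (\<exists>i j. I = {i..j}) \<and> I \<subseteq> {1..2 * n} \<and>
     (\<forall>u\<in>I. \<forall>v\<in>{1..2 * n} - I. {u, v} \<notin> M)"

definition indecomposable :: "nat \<Rightarrow> nat set set \<Rightarrow> bool" where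
  "indecomposable n M \<longleftrightarrow> (\<forall>I. interval_of n M I \<longrightarrow> I = {} \<or> I = {1..2 * n})"

text \<open>On a finite set \<open>V\<close>, \<open>rank V\<close> is the order-preserving bijection onto \<open>{1..card V}\<close>.\<close>

definition rank :: "nat set \<Rightarrow> nat \<Rightarrow> nat" where
  "rank V v = card {u \<in> V. u \<le> v}"

definition relabel :: "nat set set \<Rightarrow> nat set set" where
  "relabel F = (\<lambda>e. rank (\<Union>F) ` e) ` F"

text \<open>\<open>D\<close> is the collection of deleted edges. In a matching, the vertices left after deleting
  \<open>D\<close> together with its endpoints are exactly those of \<open>\<Union>(M - D)\<close>.\<close>

definition contains :: "nat set set \<Rightarrow> nat set set \<Rightarrow> bool" where
  "contains M N \<longleftrightarrow> (\<exists>D\<subseteq>M. N = relabel (M - D))"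

definition interleaving :: "nat \<Rightarrow> nat set set" where
  "interleaving n = (\<lambda>i. {i, i + n}) ` {1..n}"

definition right_broken_nesting :: "nat \<Rightarrow> nat set set" where
  "right_broken_nesting n = insert {n, 2 * n} ((\<lambda>i. {i, 2 * n - i}) ` {1..n - 1})"

definition left_broken_nesting :: "nat \<Rightarrow> nat set set" where
  "left_broken_nesting n = insert {1, n + 1} ((\<lambda>i. {i + 1, 2 * n - i + 1}) ` {1..n - 1})"

definition broken_nesting :: "nat \<Rightarrow> nat set set \<Rightarrow> bool" where
  "broken_nesting n N \<longleftrightarrow> N = left_broken_nesting n \<or> N = right_broken_nesting n"

definition shadow :: "nat set set \<Rightarrow> nat set" where
  "shadow P = \<Inter>{S. (\<exists>i j. S = {i..j}) \<and> \<Union>P \<subseteq> S}"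

lemma shadow_eq_Min_Max:
  assumes "finite (\<Union>P)" "\<Union>P \<noteq> {}"
  shows "shadow P = {Min (\<Union>P)..Max (\<Union>P)}"
proof
  have "\<Union>P \<subseteq> {Min (\<Union>P)..Max (\<Union>P)}"
    using assms by (meson Max_ge Min_le atLeastAtMost_iff subsetI)
  then show "shadow P \<subseteq> {Min (\<Union>P)..Max (\<Union>P)}"
    unfolding shadow_def by blast
  have "{Min (\<Union>P)..Max (\<Union>P)} \<subseteq> {i..j}" if "\<Union>P \<subseteq> {i..j}" for i j
    using that Min_in[OF assms] Max_in[OF assms]
    by (meson atLeastAtMost_iff atLeastatMost_subset_iff subsetD)
  then show "{Min (\<Union>P)..Max (\<Union>P)} \<subseteq> shadow P"
    unfolding shadow_def by blast
qed

definition splits :: "nat set \<Rightarrow> nat set \<Rightarrow> bool" where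
  "splits e S \<longleftrightarrow> (\<exists>!v. v \<in> e \<and> v \<in> S)"

text \<open>Lists are indexed from 0: the list element \<open>ps ! i\<close> is the pin $p_{i+1}$, so that
  \<open>take i ps\<close> lists the pins $p_1, \dots, p_i$ preceding it.\<close>

definition pin_sequence :: "nat set list \<Rightarrow> bool" where
  "pin_sequence ps \<longleftrightarrow>
     (\<forall>i. 1 \<le> i \<and> i < length ps \<longrightarrow> splits (ps ! i) (shadow (set (take i ps))))"

definition proper_pin_sequence :: "nat set list \<Rightarrow> bool" where
  "proper_pin_sequence ps \<longleftrightarrow> pin_sequence ps \<and>
     (\<forall>i. 2 \<le> i \<and> i < length ps \<longrightarrow> \<not> splits (ps ! i) (shadow (set (take (i - 1) ps))))"

definition proper_pin_sequence_matching :: "nat set set \<Rightarrow> bool" where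
  "proper_pin_sequence_matching N \<longleftrightarrow>
     (\<exists>ps. distinct ps \<and> set ps = N \<and> proper_pin_sequence ps)"

end

theory Submission
  imports Defs
begin

text \<open>A matching is indecomposable only if its crossing graph is connected. If an edge \<open>e\<close> is crossed
  by more than \<open>2 * (k - 1)\<^sup>2\<close> edges, then more than \<open>(k - 1)\<^sup>2\<close> of them straddle the same endpoint of \<open>e\<close> on
  the same side, so \<open>k\<close> of these are pairwise crossing (an interleaving) or pairwise nested (a broken
  nesting, after adding \<open>e\<close>). Otherwise the crossing graph has bounded degree, and some edge has
  distance \<open>k - 1\<close> from the edge \<open>e0\<close> containing the vertex 1. A shortest path from that edge towards
  \<open>e0\<close> is a proper pin sequence: since \<open>e0\<close> holds the leftmost vertex, the rest of the path beyond the
  next edge stays outside the shadow of the edges already visited.\<close>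

section \<open>Relabelling\<close>

lemma rank_less:
  assumes "finite V" "v \<in> V" "u < v"
  shows "rank V u < rank V v"
  unfolding rank_def
proof (rule psubset_card_mono)
  show "finite {w \<in> V. w \<le> v}"
    using assms by simp
  have "v \<notin> {w \<in> V. w \<le> u}" "v \<in> {w \<in> V. w \<le> v}"
    using assms by auto
  moreover have "{w \<in> V. w \<le> u} \<subseteq> {w \<in> V. w \<le> v}"
    using assms by auto
  ultimately show "{w \<in> V. w \<le> u} \<subset> {w \<in> V. w \<le> v}"
    by blast
qed

lemma bij_betw_rank:
  assumes "finite V"
  shows "bij_betw (rank V) V {1..card V}"
proof -
  have inj: "inj_on (rank V) V"
    using rank_less[OF assms] by (intro inj_onI) (metis less_irrefl linorder_neqE_nat)
  have "rank V v \<in> {1..card V}" if "v \<in> V" for v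
  proof -
    have "{u \<in> V. u \<le> v} \<noteq> {}"
      using that by auto
    then show ?thesis
      using assms unfolding rank_def by (auto simp: Suc_le_eq card_gt_0_iff intro: card_mono)
  qed
  then have "rank V ` V \<subseteq> {1..card V}"
    by auto
  moreover have "card (rank V ` V) = card {1..card V}"
    using inj by (simp add: card_image)
  ultimately have "rank V ` V = {1..card V}"
    by (intro card_subset_eq) auto
  with inj show ?thesis
    by (simp add: bij_betw_def)
qed

lemma rank_strict_mono_on_image:
  assumes "strict_mono_on {1..m} g" "i \<in> {1..m}"
  shows "rank (g ` {1..m}) (g i) = i"
proof -
  have "{u \<in> g ` {1..m}. u \<le> g i} = g ` {1..i}"
    using assms strict_mono_on_less_eq[OF assms(1)] by auto
  moreover have "inj_on g {1..i}"
    using assms by (intro inj_on_subset[OF strict_mono_on_imp_inj_on[OF assms(1)]]) auto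
  ultimately show ?thesis
    by (simp add: rank_def card_image)
qed

text \<open>\<open>rank\<close> on the image of \<open>g\<close> inverts \<open>g\<close>, because
  \<open>g i\<close> has exactly \<open>i\<close> image points at or below it. Containment of a
  pattern can thus be proved by exhibiting an increasing embedding, without computing ranks.\<close>

lemma relabel_strict_mono_on_image:
  assumes "\<Union>N = {1..m}" "strict_mono_on {1..m} g"
  shows "relabel ((`) g ` N) = N"
proof -
  have U: "\<Union>((`) g ` N) = g ` {1..m}"
    using assms(1) by blast
  have "rank (g ` {1..m}) ` g ` e = e" if "e \<in> N" for e
  proof -
    have "e \<subseteq> {1..m}"
      using that assms(1) by blast
    then have "rank (g ` {1..m}) (g i) = i" if "i \<in> e" for i
      using rank_strict_mono_on_image[OF assms(2)] that by blast
    then show ?thesis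
      by (simp add: image_image)
  qed
  then show ?thesis
    unfolding relabel_def U by (simp add: image_image)
qed

section \<open>Shadows and splitting under order-preserving maps\<close>

lemma mem_shadow_iff:
  assumes "finite (\<Union>P)"
  shows "v \<in> shadow P \<longleftrightarrow> (\<exists>a\<in>\<Union>P. \<exists>b\<in>\<Union>P. a \<le> v \<and> v \<le> b)"
proof (cases "\<Union>P = {}")
  case True
  \<comment> \<open>\<open>{1..0}\<close> is an empty segment and takes part in the intersection, so
    the shadow of an empty vertex set is empty.\<close>
  then have "shadow P \<subseteq> {1..0}"
    unfolding shadow_def by blast
  then show ?thesis
    using True by auto
next
  case False
  then show ?thesis
    using assms Min_in[OF assms False] Max_in[OF assms False]
    unfolding shadow_eq_Min_Max[OF assms False]
    by (meson Max_ge Min_le atLeastAtMost_iff order_trans)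
qed

text \<open>The shadow itself is not preserved, as vertices between those of \<open>V\<close> may
  disappear. Membership of vertices of \<open>V\<close> is, since it only compares elements of
  \<open>V\<close>; that is all that splitting by \<open>e\<close> looks at.\<close>

lemma splits_image_iff:
  assumes "strict_mono_on V r" "finite V" "e \<subseteq> V" "\<Union>P \<subseteq> V"
  shows "splits (r ` e) (shadow ((`) r ` P)) \<longleftrightarrow> splits e (shadow P)"
proof -
  have fin: "finite (\<Union>P)" "finite (\<Union>((`) r ` P))"
    using assms(2,4) by (auto simp: finite_subset simp flip: image_Union)
  have mem: "r v \<in> shadow ((`) r ` P) \<longleftrightarrow> v \<in> shadow P" if "v \<in> V" for v
  proof -
    have "(\<exists>a\<in>r ` \<Union>P. \<exists>b\<in>r ` \<Union>P. a \<le> r v \<and> r v \<le> b) \<longleftrightarrow>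
          (\<exists>a\<in>\<Union>P. \<exists>b\<in>\<Union>P. r a \<le> r v \<and> r v \<le> r b)"
      by blast
    also have "\<dots> \<longleftrightarrow> (\<exists>a\<in>\<Union>P. \<exists>b\<in>\<Union>P. a \<le> v \<and> v \<le> b)"
      using strict_mono_on_less_eq[OF assms(1)] that assms(4) by (meson subsetD)
    finally show ?thesis
      by (simp add: mem_shadow_iff fin image_Union)
  qed
  have inj: "inj_on r V"
    using assms(1) strict_mono_on_imp_inj_on by blast
  show ?thesis
    unfolding splits_def
  proof
    assume "\<exists>!v. v \<in> r ` e \<and> v \<in> shadow ((`) r ` P)"
    then show "\<exists>!v. v \<in> e \<and> v \<in> shadow P"
      using mem assms(3) inj by (smt (verit, best) image_iff inj_on_def subsetD)
  next
    assume "\<exists>!v. v \<in> e \<and> v \<in> shadow P"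
    then show "\<exists>!v. v \<in> r ` e \<and> v \<in> shadow ((`) r ` P)"
      using mem assms(3) by (smt (verit, best) image_iff subsetD)
  qed
qed

lemma proper_pin_sequence_matching_relabel:
  assumes "finite (\<Union>(set ps))" "distinct ps" "proper_pin_sequence ps"
  shows "proper_pin_sequence_matching (relabel (set ps))"
proof -
  let ?V = "\<Union>(set ps)"
  let ?r = "rank ?V"
  let ?qs = "map ((`) ?r) ps"
  have mono: "strict_mono_on ?V ?r"
    using rank_less[OF assms(1)] by (intro strict_mono_onI) blast
  have splits: "splits (?qs ! i) (shadow (set (take j ?qs))) \<longleftrightarrow> splits (ps ! i) (shadow (set (take j ps)))"
    if "i < length ps" for i j
  proof -
    have "ps ! i \<subseteq> ?V" "\<Union>(set (take j ps)) \<subseteq> ?V"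
      using nth_mem[OF that] set_take_subset[of j ps] by blast+
    then show ?thesis
      using splits_image_iff[OF mono assms(1), of "ps ! i" "set (take j ps)"] that
      by (simp add: take_map)
  qed
  have "inj_on ((`) ?r) (set ps)"
    using inj_on_image[OF strict_mono_on_imp_inj_on[OF mono]] by simp
  then have "distinct ?qs"
    using assms(2) by (simp add: distinct_map)
  moreover have "proper_pin_sequence ?qs"
    using assms(3) splits unfolding proper_pin_sequence_def pin_sequence_def by simp
  ultimately show ?thesis
    unfolding proper_pin_sequence_matching_def relabel_def by (intro exI[of _ ?qs]) simp
qed

section \<open>Chains and antichains\<close>

text \<open>The minimal elements form an antichain; a chain avoiding all of them can be extended downwards.\<close>

lemma chain_or_antichain:
  fixes R :: "'a \<Rightarrow> 'a \<Rightarrow> bool"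
  assumes "transp R" "finite X" "a * b < card X"
  shows "(\<exists>xs. length xs = Suc a \<and> sorted_wrt R xs \<and> set xs \<subseteq> X) \<or>
         (\<exists>A\<subseteq>X. card A = Suc b \<and> (\<forall>x\<in>A. \<forall>y\<in>A. \<not> R x y))"
  using assms(2,3)
proof (induction a arbitrary: X)
  case 0
  then obtain x where "x \<in> X"
    by fastforce
  then show ?case
    by (intro disjI1 exI[of _ "[x]"]) auto
next
  case (Suc a)
  define Y where "Y = {x \<in> X. \<forall>z\<in>X. \<not> R z x}"
  show ?case
  proof (cases "card Y > b")
    case True
    then obtain A where "A \<subseteq> Y" "card A = Suc b"
      by (meson Suc_le_eq obtain_subset_with_card_n)
    then show ?thesis
      unfolding Y_def by (intro disjI2 exI[of _ A]) auto
  next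
    case False
    have "card (X - Y) = card X - card Y"
      using Suc.prems by (intro card_Diff_subset) (auto simp: Y_def)
    \<comment> \<open>At most \<open>b\<close> elements are removed from a set with more than
      \<open>a * b + b\<close> elements.\<close>
    then have "a * b < card (X - Y)"
      using False Suc.prems(2) by simp
    then consider xs where "length xs = Suc a" "sorted_wrt R xs" "set xs \<subseteq> X - Y"
      | A where "A \<subseteq> X - Y" "card A = Suc b" "\<forall>x\<in>A. \<forall>y\<in>A. \<not> R x y"
      using Suc.IH[of "X - Y"] Suc.prems(1) by auto
    then show ?thesis
    proof cases
      case 1
      then obtain y ys where xs: "xs = y # ys"
        by (cases xs) auto
      then obtain z where z: "z \<in> X" "R z y"
        using 1(3) by (auto simp: Y_def)
      then have "sorted_wrt R (z # xs)"
        using 1(2) assms(1) xs by (auto dest: transpD)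
      then show ?thesis
        using 1 z by (intro disjI1 exI[of _ "z # xs"]) auto
    next
      case 2
      then show ?thesis
        by blast
    qed
  qed
qed

text \<open>The case \<open>b = 1\<close> of the dichotomy: two elements of an antichain would
  contradict totality. It lists a nested family from the outermost edge inwards.\<close>

lemma chain_if_total:
  fixes R :: "'a \<Rightarrow> 'a \<Rightarrow> bool"
  assumes "transp R" "card A = Suc a" "\<And>x y. x \<in> A \<Longrightarrow> y \<in> A \<Longrightarrow> x \<noteq> y \<Longrightarrow> R x y \<or> R y x"
  obtains xs where "length xs = Suc a" "sorted_wrt R xs" "set xs \<subseteq> A"
proof -
  have "finite A"
    using assms(2) by (metis card.infinite nat.distinct(1))
  moreover have False if "B \<subseteq> A" "card B = Suc 1" "\<forall>x\<in>B. \<forall>y\<in>B. \<not> R x y" for B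
  proof -
    obtain x y where "B = {x, y}" "x \<noteq> y"
      using \<open>card B = Suc 1\<close> by (auto simp: card_Suc_eq)
    then show False
      using that assms(3)[of x y] by simp
  qed
  moreover have "a * 1 < card A"
    using assms(2) by simp
  ultimately show ?thesis
    using chain_or_antichain[OF assms(1), of A a 1] that by blast
qed

section \<open>Crossing edges\<close>

definition hull :: "nat set \<Rightarrow> nat set" where
  "hull e = {Min e..Max e}"

text \<open>Edges are viewed as arcs over the line. In the first case \<open>f\<close> straddles the
  right endpoint of \<open>e\<close>, in the second the left one; the two cases later lead to left-
  and right-broken nestings.\<close>

definition cross :: "nat set \<Rightarrow> nat set \<Rightarrow> bool" where
  "cross e f \<longleftrightarrow> Min e < Min f \<and> Min f < Max e \<and> Max e < Max f \<or>
                 Min f < Min e \<and> Min e < Max f \<and> Max f < Max e"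

lemma cross_sym: "cross e f \<Longrightarrow> cross f e"
  unfolding cross_def by blast

locale matching_graph =
  fixes n :: nat and M :: "nat set set"
  assumes is_matching: "matching n M"
begin

lemma finite_edges: "finite M"
  using is_matching unfolding matching_def
  by (intro finite_subset[of M "Pow {1..2 * n}"]) blast+

lemma edge_eq:
  assumes "e \<in> M"
  shows "e = {Min e, Max e}" "Min e < Max e" "1 \<le> Min e" "Max e \<le> 2 * n"
proof -
  obtain x y where "e = {x, y}" "x \<noteq> y" and sub: "e \<subseteq> {1..2 * n}"
    using assms is_matching unfolding matching_def by (meson card_2_iff)
  then show "e = {Min e, Max e}" "Min e < Max e" "1 \<le> Min e" "Max e \<le> 2 * n"
    by (auto simp: min_def max_def)
qed

lemma edge_mem:
  assumes "e \<in> M"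
  shows "{Min e, Max e} \<in> M"
  using assms by (subst edge_eq(1)[OF assms, symmetric])

lemma finite_edge:
  assumes "e \<in> M"
  shows "finite e" "e \<noteq> {}"
  using assms is_matching card_gt_0_iff[of e] unfolding matching_def by auto

lemma Min_in_edge: "e \<in> M \<Longrightarrow> Min e \<in> e"
  using finite_edge by (intro Min_in)

lemma Max_in_edge: "e \<in> M \<Longrightarrow> Max e \<in> e"
  using finite_edge by (intro Max_in)

lemma edge_unique:
  assumes "e \<in> M" "f \<in> M" "v \<in> e" "v \<in> f"
  shows "e = f"
proof -
  have "v \<in> {1..2 * n}"
    using assms is_matching unfolding matching_def by blast
  then have "\<exists>!e. e \<in> M \<and> v \<in> e"
    using is_matching unfolding matching_def by blast
  then show ?thesis
    using assms by blast
qed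

lemma Min_Max_edge_distinct:
  assumes "e \<in> M" "f \<in> M" "e \<noteq> f"
  shows "Min e \<noteq> Min f" "Max e \<noteq> Max f" "Min e \<noteq> Max f" "Max e \<noteq> Min f"
  using edge_unique[OF assms(1,2)] Min_in_edge Max_in_edge assms by metis+

section \<open>Submatchings and embedded patterns\<close>

lemma matching_relabel:
  assumes "F \<subseteq> M" "card (\<Union>F) = 2 * k"
  shows "matching k (relabel F)"
proof -
  let ?V = "\<Union>F"
  have fin: "finite ?V"
    using assms(1) is_matching unfolding matching_def
    by (intro finite_subset[of ?V "{1..2 * n}"]) blast+
  then have bij: "bij_betw (rank ?V) ?V {1..2 * k}"
    using bij_betw_rank assms(2) by metis
  then have inj: "inj_on (rank ?V) ?V"
    by (simp add: bij_betw_def)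
  have "rank ?V ` e \<subseteq> {1..2 * k} \<and> card (rank ?V ` e) = 2" if "e \<in> F" for e
  proof
    have sub: "e \<subseteq> ?V"
      using that by blast
    then show "rank ?V ` e \<subseteq> {1..2 * k}"
      using bij unfolding bij_betw_def by blast
    have "card e = 2"
      using is_matching that assms(1) unfolding matching_def by blast
    then show "card (rank ?V ` e) = 2"
      using card_image[OF inj_on_subset[OF inj sub]] by simp
  qed
  moreover have "\<exists>!e. e \<in> relabel F \<and> v \<in> e" if v: "v \<in> {1..2 * k}" for v
  proof -
    obtain u e where u: "u \<in> e" "e \<in> F" "v = rank ?V u"
      using v bij unfolding bij_betw_def by blast
    have "rank ?V ` e' = rank ?V ` e" if "e' \<in> F" "v \<in> rank ?V ` e'" for e'
    proof -
      obtain w where w: "w \<in> e'" "v = rank ?V w"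
        using \<open>v \<in> rank ?V ` e'\<close> by blast
      then have "w = u"
        using inj u that(1) by (metis UnionI inj_onD)
      then show ?thesis
        using edge_unique w u that(1) assms(1) by blast
    qed
    then show ?thesis
      using u unfolding relabel_def by blast
  qed
  ultimately show ?thesis
    unfolding matching_def by (auto simp: relabel_def)
qed

lemma contains_relabel:
  assumes "F \<subseteq> M"
  shows "contains M (relabel F)"
  using assms unfolding contains_def by (intro exI[of _ "M - F"]) (simp add: double_diff)

text \<open>Deleting every edge outside the image of \<open>N\<close> and relabelling gives back
  \<open>N\<close>. Being a matching comes along, since any relabelled subset of \<open>M\<close> is
  one.\<close>

lemma contains_if_embeds:
  assumes "\<Union>N = {1..2 * k}" "strict_mono_on {1..2 * k} g" "\<And>e. e \<in> N \<Longrightarrow> g ` e \<in> M"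
  shows "matching k N \<and> contains M N"
proof -
  let ?F = "(`) g ` N"
  have F: "?F \<subseteq> M"
    using assms(3) by blast
  have "\<Union>?F = g ` {1..2 * k}"
    using assms(1) by blast
  then have "card (\<Union>?F) = 2 * k"
    using card_image[OF strict_mono_on_imp_inj_on[OF assms(2)]] by simp
  then show ?thesis
    using matching_relabel[OF F] contains_relabel[OF F] relabel_strict_mono_on_image[OF assms(1,2)]
    by simp
qed

lemma contains_interleaving:
  assumes xs: "length xs = k" "set xs \<subseteq> M"
    and sorted: "sorted_wrt (\<lambda>e f. Min e < Min f \<and> Max e < Max f) xs"
    and p: "\<And>e. e \<in> set xs \<Longrightarrow> Min e < p \<and> p < Max e"
  shows "matching k (interleaving k) \<and> contains M (interleaving k)"
proof (rule contains_if_embeds)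
  \<comment> \<open>Vertices \<open>i\<close> and \<open>i + k\<close> go to the two endpoints of
    the \<open>i\<close>-th listed edge; the point \<open>p\<close> separates the two halves of the
    image.\<close>
  define g where "g i = (if i \<le> k then Min (xs ! (i - 1)) else Max (xs ! (i - k - 1)))" for i
  have less: "Min (xs ! i) < Min (xs ! j) \<and> Max (xs ! i) < Max (xs ! j)" if "i < j" "j < k" for i j
    using sorted_wrt_nth_less[OF sorted that(1)] that xs(1) by simp
  have p': "Min (xs ! i) < p \<and> p < Max (xs ! i)" if "i < k" for i
    using p that xs(1) by simp
  show "strict_mono_on {1..2 * k} g"
  proof (rule strict_mono_onI)
    fix r s assume rs: "r \<in> {1..2 * k}" "s \<in> {1..2 * k}" "r < s"
    consider "s \<le> k" | "r \<le> k" "k < s" | "k < r"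
      by linarith
    then show "g r < g s"
    proof cases
      case 1
      then show ?thesis
        using rs less[of "r - 1" "s - 1"] by (auto simp: g_def)
    next
      case 2
      then show ?thesis
        using rs p'[of "r - 1"] p'[of "s - k - 1"] by (intro less_trans[of "g r" p "g s"]) (auto simp: g_def)
    next
      case 3
      then show ?thesis
        using rs less[of "r - k - 1" "s - k - 1"] by (auto simp: g_def)
    qed
  qed
  show "\<Union>(interleaving k) = {1..2 * k}"
  proof
    show "{1..2 * k} \<subseteq> \<Union>(interleaving k)"
    proof
      fix v assume v: "v \<in> {1..2 * k}"
      show "v \<in> \<Union>(interleaving k)"
      proof (cases "v \<le> k")
        case True
        then show ?thesis
          using v unfolding interleaving_def by (intro UnionI[of "{v, v + k}"]) auto
      next
        case False
        then show ?thesis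
          using v unfolding interleaving_def
          by (intro UnionI[of "{v - k, v - k + k}"] imageI) auto
      qed
    qed
  qed (auto simp: interleaving_def)
  fix e assume "e \<in> interleaving k"
  then obtain i where i: "e = {i, i + k}" "1 \<le> i" "i \<le> k"
    unfolding interleaving_def by auto
  then have "xs ! (i - 1) \<in> M"
    using xs by (metis Suc_le_eq Suc_pred' less_le_trans nth_mem subsetD zero_less_one)
  moreover have "g ` e = {Min (xs ! (i - 1)), Max (xs ! (i - 1))}"
    using i by (simp add: g_def insert_commute)
  ultimately show "g ` e \<in> M"
    using edge_mem by simp
qed

lemma contains_left_broken_nesting:
  assumes xs: "length xs = k" "set xs \<subseteq> M" and "0 < k" and e: "e \<in> M"
    and sorted: "sorted_wrt (\<lambda>e f. Min e < Min f \<and> Max f < Max e) xs"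
    and crossing: "\<And>f. f \<in> set xs \<Longrightarrow> Min e < Min f \<and> Min f < Max e \<and> Max e < Max f"
  shows "matching k (left_broken_nesting k) \<and> contains M (left_broken_nesting k)"
proof (rule contains_if_embeds)
  \<comment> \<open>The edge \<open>e\<close> plays the role of \<open>{1, k + 1}\<close>. The list
    entry at index \<open>j\<close> carries the vertices \<open>j + 2\<close> and
    \<open>2 * k - j\<close>, for \<open>j < k - 1\<close>.\<close>
  define g where "g i = (if i \<le> 1 then Min e else if i \<le> k then Min (xs ! (i - 2))
    else if i = k + 1 then Max e else Max (xs ! (2 * k - i)))" for i
  have less: "Min (xs ! i) < Min (xs ! j) \<and> Max (xs ! j) < Max (xs ! i)" if "i < j" "j < k" for i j
    using sorted_wrt_nth_less[OF sorted that(1)] that xs(1) by simp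
  have cr: "Min e < Min (xs ! i) \<and> Min (xs ! i) < Max e \<and> Max e < Max (xs ! i)" if "i < k" for i
    using crossing that xs(1) by simp
  have "Min e < Max e"
    using e edge_eq(2) by blast
  show "strict_mono_on {1..2 * k} g"
  proof (rule strict_mono_onI)
    fix r s assume rs: "r \<in> {1..2 * k}" "s \<in> {1..2 * k}" "r < s"
    have low: "Min e < g i \<and> g i < Max e" if "1 < i" "i \<le> k" for i
      using cr[of "i - 2"] that by (simp add: g_def)
    have high: "Max e < g i" if "k + 1 < i" "i \<le> 2 * k" for i
      using cr[of "2 * k - i"] that by (simp add: g_def)
    have ends: "g 1 = Min e" "g (k + 1) = Max e"
      using \<open>0 < k\<close> by (simp_all add: g_def)
    consider "r = 1" | "1 < r" "s \<le> k" | "1 < r" "r \<le> k" "k < s" | "r = k + 1" | "k + 1 < r"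
      using rs by fastforce
    then show "g r < g s"
    proof cases
      case 1
      then show ?thesis
        using rs ends low[of s] high[of s] \<open>Min e < Max e\<close> by (cases s "k + 1" rule: linorder_cases) auto
    next
      case 2
      then show ?thesis
        using rs less[of "r - 2" "s - 2"] by (simp add: g_def)
    next
      case 3
      then show ?thesis
        using rs ends low[of r] high[of s] by (cases "s = k + 1") auto
    next
      case 4
      then show ?thesis
        using rs ends high[of s] by simp
    next
      case 5
      then show ?thesis
        using rs less[of "2 * k - s" "2 * k - r"] by (simp add: g_def)
    qed
  qed
  show "\<Union>(left_broken_nesting k) = {1..2 * k}"
  proof
    show "{1..2 * k} \<subseteq> \<Union>(left_broken_nesting k)"
    proof
      fix v assume v: "v \<in> {1..2 * k}"
      consider "v = 1 \<or> v = k + 1" | "2 \<le> v" "v \<le> k" | "k + 2 \<le> v"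
        using v by fastforce
      then show "v \<in> \<Union>(left_broken_nesting k)"
      proof cases
        case 1
        then show ?thesis
          unfolding left_broken_nesting_def by auto
      next
        case 2
        then have "v \<in> {(v - 1) + 1, 2 * k - (v - 1) + 1}" "v - 1 \<in> {1..k - 1}"
          by auto
        then show ?thesis
          unfolding left_broken_nesting_def by blast
      next
        case 3
        then have "v \<in> {(2 * k + 1 - v) + 1, 2 * k - (2 * k + 1 - v) + 1}" "2 * k + 1 - v \<in> {1..k - 1}"
          using v by auto
        then show ?thesis
          unfolding left_broken_nesting_def by blast
      qed
    qed
  qed (use \<open>0 < k\<close> in \<open>auto simp: left_broken_nesting_def\<close>)
  fix f assume "f \<in> left_broken_nesting k"
  then consider "f = {1, k + 1}" | i where "f = {i + 1, 2 * k - i + 1}" "1 \<le> i" "i \<le> k - 1"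
    unfolding left_broken_nesting_def by auto
  then show "g ` f \<in> M"
  proof cases
    case 1
    then have "g ` f = {Min e, Max e}"
      using \<open>0 < k\<close> by (simp add: g_def insert_commute)
    then show ?thesis
      using edge_mem[OF e] by simp
  next
    case 2
    then have "xs ! (i - 1) \<in> M"
      using xs \<open>0 < k\<close> by (intro subsetD[OF xs(2)] nth_mem) auto
    moreover have "g (i + 1) = Min (xs ! (i - 1))" "g (2 * k - i + 1) = Max (xs ! (i - 1))"
      using 2 \<open>0 < k\<close> by (auto simp: g_def Suc_diff_le intro: arg_cong[of _ _ "\<lambda>j. Max (xs ! j)"])
    ultimately show ?thesis
      using 2 edge_mem by simp
  qed
qed

lemma contains_right_broken_nesting:
  assumes xs: "length xs = k" "set xs \<subseteq> M" and "0 < k" and e: "e \<in> M"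
    and sorted: "sorted_wrt (\<lambda>e f. Min e < Min f \<and> Max f < Max e) xs"
    and crossing: "\<And>f. f \<in> set xs \<Longrightarrow> Min f < Min e \<and> Min e < Max f \<and> Max f < Max e"
  shows "matching k (right_broken_nesting k) \<and> contains M (right_broken_nesting k)"
proof (rule contains_if_embeds)
  \<comment> \<open>Here \<open>e\<close> plays the role of \<open>{k, 2 * k}\<close>, and the list
    entry at index \<open>j\<close> carries the vertices \<open>j + 1\<close> and
    \<open>2 * k - j - 1\<close>, for \<open>j < k - 1\<close>.\<close>
  define g where "g i = (if i < k then Min (xs ! (i - 1)) else if i = k then Min e
    else if i = 2 * k then Max e else Max (xs ! (2 * k - i - 1)))" for i
  have less: "Min (xs ! i) < Min (xs ! j) \<and> Max (xs ! j) < Max (xs ! i)" if "i < j" "j < k" for i j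
    using sorted_wrt_nth_less[OF sorted that(1)] that xs(1) by simp
  have cr: "Min (xs ! i) < Min e \<and> Min e < Max (xs ! i) \<and> Max (xs ! i) < Max e" if "i < k" for i
    using crossing that xs(1) by simp
  have "Min e < Max e"
    using e edge_eq(2) by blast
  show "strict_mono_on {1..2 * k} g"
  proof (rule strict_mono_onI)
    fix r s assume rs: "r \<in> {1..2 * k}" "s \<in> {1..2 * k}" "r < s"
    have low: "g i < Min e" if "1 \<le> i" "i < k" for i
      using cr[of "i - 1"] that by (simp add: g_def)
    have high: "Min e < g i \<and> g i < Max e" if "k < i" "i < 2 * k" for i
      using cr[of "2 * k - i - 1"] that by (simp add: g_def)
    have ends: "g k = Min e" "g (2 * k) = Max e"
      using \<open>0 < k\<close> by (simp_all add: g_def)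
    consider "s = 2 * k" | "s < k" | "r < k" "k \<le> s" "s < 2 * k" | "r = k" "s < 2 * k" | "k < r" "s < 2 * k"
      using rs by fastforce
    then show "g r < g s"
    proof cases
      case 1
      then show ?thesis
        using rs ends low[of r] high[of r] \<open>Min e < Max e\<close> by (cases r k rule: linorder_cases) auto
    next
      case 2
      then show ?thesis
        using rs less[of "r - 1" "s - 1"] by (simp add: g_def)
    next
      case 3
      then show ?thesis
        using rs ends low[of r] high[of s] by (cases "s = k") auto
    next
      case 4
      then show ?thesis
        using rs ends high[of s] by simp
    next
      case 5
      then show ?thesis
        using rs less[of "2 * k - s - 1" "2 * k - r - 1"] by (simp add: g_def)
    qed
  qed
  show "\<Union>(right_broken_nesting k) = {1..2 * k}"
  proof
    show "{1..2 * k} \<subseteq> \<Union>(right_broken_nesting k)"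
    proof
      fix v assume v: "v \<in> {1..2 * k}"
      consider "v = k \<or> v = 2 * k" | "v < k" | "k < v" "v < 2 * k"
        using v by fastforce
      then show "v \<in> \<Union>(right_broken_nesting k)"
      proof cases
        case 1
        then show ?thesis
          unfolding right_broken_nesting_def by auto
      next
        case 2
        then have "v \<in> {1..k - 1}"
          using v by auto
        then show ?thesis
          unfolding right_broken_nesting_def by blast
      next
        case 3
        then have "v \<in> {2 * k - v, 2 * k - (2 * k - v)}" "2 * k - v \<in> {1..k - 1}"
          using v by auto
        then show ?thesis
          unfolding right_broken_nesting_def by blast
      qed
    qed
  qed (use \<open>0 < k\<close> in \<open>auto simp: right_broken_nesting_def\<close>)
  fix f assume "f \<in> right_broken_nesting k"
  then consider "f = {k, 2 * k}" | i where "f = {i, 2 * k - i}" "1 \<le> i" "i \<le> k - 1"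
    unfolding right_broken_nesting_def by auto
  then show "g ` f \<in> M"
  proof cases
    case 1
    then have "g ` f = {Min e, Max e}"
      using \<open>0 < k\<close> by (simp add: g_def insert_commute)
    then show ?thesis
      using edge_mem[OF e] by simp
  next
    case 2
    then have "xs ! (i - 1) \<in> M"
      using xs \<open>0 < k\<close> by (intro subsetD[OF xs(2)] nth_mem) auto
    moreover have "g i = Min (xs ! (i - 1))" "g (2 * k - i) = Max (xs ! (i - 1))"
      using 2 \<open>0 < k\<close> by (auto simp: g_def)
    ultimately show ?thesis
      using 2 edge_mem by simp
  qed
qed

section \<open>Bounded degree in the crossing graph\<close>

definition has_nesting_or_interleaving :: "nat \<Rightarrow> bool" where
  "has_nesting_or_interleaving k \<longleftrightarrow> (\<exists>N. matching k N \<and> (broken_nesting k N \<or> N = interleaving k) \<and> contains M N)"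

text \<open>An antichain for the order used here is a nested family, as distinct edges share no endpoint.\<close>

lemma straddling_chain:
  assumes X: "X \<subseteq> M" "(k - 1)\<^sup>2 < card X" and p: "\<And>e. e \<in> X \<Longrightarrow> Min e < p \<and> p < Max e"
    and "0 < k" "\<not> has_nesting_or_interleaving k"
  obtains xs where "length xs = k" "set xs \<subseteq> X"
    "sorted_wrt (\<lambda>e f. Min e < Min f \<and> Max f < Max e) xs"
proof -
  have fin: "finite X"
    using X(1) finite_edges finite_subset by blast
  let ?R = "\<lambda>e f :: nat set. Min e < Min f \<and> Max e < Max f"
  let ?R' = "\<lambda>e f :: nat set. Min e < Min f \<and> Max f < Max e"
  have trans: "transp ?R" "transp ?R'"
    by (auto intro: transpI)
  have k: "Suc (k - 1) = k"
    using \<open>0 < k\<close> by simp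
  consider xs where "length xs = k" "sorted_wrt ?R xs" "set xs \<subseteq> X"
    | A where "A \<subseteq> X" "card A = k" "\<forall>x\<in>A. \<forall>y\<in>A. \<not> ?R x y"
    using chain_or_antichain[OF trans(1) fin, of "k - 1" "k - 1"] X(2) k by (auto simp: power2_eq_square)
  then show ?thesis
  proof cases
    case 1
    then have "matching k (interleaving k) \<and> contains M (interleaving k)"
      using contains_interleaving[of xs k p] X(1) p by blast
    then show ?thesis
      using \<open>\<not> has_nesting_or_interleaving k\<close> unfolding has_nesting_or_interleaving_def by blast
  next
    case 2
    have "?R' x y \<or> ?R' y x" if "x \<in> A" "y \<in> A" "x \<noteq> y" for x y
      using Min_Max_edge_distinct[of x y] that 2 X(1) by (meson linorder_neqE_nat subsetD)
    moreover have "card A = Suc (k - 1)"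
      using 2 k by simp
    ultimately obtain xs where "length xs = Suc (k - 1)" "sorted_wrt ?R' xs" "set xs \<subseteq> A"
      using chain_if_total[OF trans(2), of A "k - 1"] by blast
    then show ?thesis
      using that 2 k by simp
  qed
qed

lemma degree_bound:
  assumes "e \<in> M" "0 < k" "\<not> has_nesting_or_interleaving k"
  shows "card {f \<in> M. cross e f} \<le> 2 * (k - 1)\<^sup>2"
proof -
  \<comment> \<open>All of \<open>X\<close> straddles \<open>Max e\<close>, and a nested family in
    it forms a left-broken nesting with \<open>e\<close>. All of \<open>Y\<close> straddles
    \<open>Min e\<close> and likewise yields a right-broken nesting.\<close>
  define X where "X = {f \<in> M. Min e < Min f \<and> Min f < Max e \<and> Max e < Max f}"
  define Y where "Y = {f \<in> M. Min f < Min e \<and> Min e < Max f \<and> Max f < Max e}"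
  have "card X \<le> (k - 1)\<^sup>2"
  proof (rule ccontr)
    assume "\<not> card X \<le> (k - 1)\<^sup>2"
    then have "(k - 1)\<^sup>2 < card X" "X \<subseteq> M" "\<And>f. f \<in> X \<Longrightarrow> Min f < Max e \<and> Max e < Max f"
      unfolding X_def by auto
    then obtain xs where "length xs = k" "set xs \<subseteq> X"
      "sorted_wrt (\<lambda>e f. Min e < Min f \<and> Max f < Max e) xs"
      using straddling_chain[of X k "Max e"] assms by blast
    then have "matching k (left_broken_nesting k) \<and> contains M (left_broken_nesting k)"
      using contains_left_broken_nesting[of xs k e] assms unfolding X_def by blast
    then show False
      using assms(3) unfolding has_nesting_or_interleaving_def broken_nesting_def by blast
  qed
  moreover have "card Y \<le> (k - 1)\<^sup>2"
  proof (rule ccontr)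
    assume "\<not> card Y \<le> (k - 1)\<^sup>2"
    then have "(k - 1)\<^sup>2 < card Y" "Y \<subseteq> M" "\<And>f. f \<in> Y \<Longrightarrow> Min f < Min e \<and> Min e < Max f"
      unfolding Y_def by auto
    then obtain xs where "length xs = k" "set xs \<subseteq> Y"
      "sorted_wrt (\<lambda>e f. Min e < Min f \<and> Max f < Max e) xs"
      using straddling_chain[of Y k "Min e"] assms by blast
    then have "matching k (right_broken_nesting k) \<and> contains M (right_broken_nesting k)"
      using contains_right_broken_nesting[of xs k e] assms unfolding Y_def by blast
    then show False
      using assms(3) unfolding has_nesting_or_interleaving_def broken_nesting_def by blast
  qed
  moreover have "{f \<in> M. cross e f} = X \<union> Y"
    unfolding X_def Y_def cross_def by blast
  ultimately show ?thesis
    using card_Un_le[of X Y] by simp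
qed

section \<open>Hulls, shadows and connectivity of the crossing graph\<close>

lemma edge_subset_hull: "e \<in> M \<Longrightarrow> e \<subseteq> hull e"
  using finite_edge unfolding hull_def by auto

text \<open>The two edges are distinct, hence share no endpoint, and all inequalities between their
  endpoints become strict. This is how a failure of the interval property produces a
  crossing.\<close>

lemma cross_if_leaves_hull:
  assumes "e \<in> M" "f \<in> M" "x \<in> f" "x \<in> hull e" "y \<in> f" "y \<notin> hull e"
  shows "cross e f"
proof -
  have "e \<noteq> f"
    using assms edge_subset_hull by blast
  then have "Min e \<noteq> Min f" "Max e \<noteq> Max f" "Min e \<noteq> Max f" "Max e \<noteq> Min f"
    using Min_Max_edge_distinct assms by blast+
  moreover have "x = Min f \<or> x = Max f" "y = Min f \<or> y = Max f"
    using edge_eq(1)[OF assms(2)] assms(3,5) by blast+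
  ultimately show ?thesis
    using assms(4,6) edge_eq(2)[OF assms(1)] edge_eq(2)[OF assms(2)]
    unfolding cross_def hull_def by auto
qed

lemma cross_ex1_hull:
  assumes "e \<in> M" "f \<in> M" "cross e f"
  shows "\<exists>!v. v \<in> f \<and> v \<in> hull e"
proof -
  have f: "v \<in> f \<longleftrightarrow> v = Min f \<or> v = Max f" for v
    using edge_eq(1)[OF assms(2)] by blast
  have "Min f \<in> hull e \<longleftrightarrow> Max f \<notin> hull e"
    using assms(3) edge_eq(2)[OF assms(1)] edge_eq(2)[OF assms(2)]
    unfolding cross_def hull_def by auto
  then show ?thesis
    unfolding f by blast
qed

lemma card_Union_edges:
  assumes "F \<subseteq> M"
  shows "card (\<Union>F) = 2 * card F"
proof -
  have "pairwise disjnt F"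
    using assms edge_unique unfolding pairwise_def disjnt_iff by blast
  moreover have "card e = 2" if "e \<in> F" for e
    using that assms is_matching unfolding matching_def by blast
  ultimately show ?thesis
    using card_Union_disjoint[of F] assms finite_edge by (simp add: subset_iff)
qed

text \<open>Any segment containing both endpoints of an edge contains its hull. So once the union of
  hulls has no gaps, it is the smallest segment around the endpoints.\<close>

lemma shadow_eq_Union_hull:
  assumes "P \<subseteq> M" "(\<Union>e\<in>P. hull e) = {a..b}"
  shows "shadow P = {a..b}"
proof
  have "\<Union>P \<subseteq> {a..b}"
    using edge_subset_hull assms by fast
  then show "shadow P \<subseteq> {a..b}"
    unfolding shadow_def by blast
  have "hull e \<subseteq> {i..j}" if "e \<in> P" "\<Union>P \<subseteq> {i..j}" for e i j
  proof -
    have "Min e \<in> {i..j}" "Max e \<in> {i..j}"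
      using that Min_in_edge[of e] Max_in_edge[of e] assms(1) by blast+
    then show ?thesis
      unfolding hull_def by simp
  qed
  then show "{a..b} \<subseteq> shadow P"
    unfolding shadow_def assms(2)[symmetric] by blast
qed

text \<open>The leftmost maximal segment covered by the edges of \<open>Q\<close> is an interval of the matching,
  hence everything.\<close>

lemma indecomposable_cross_closed:
  assumes "indecomposable n M" "Q \<subseteq> M" "Q \<noteq> {}"
    and closed: "\<And>e f. e \<in> Q \<Longrightarrow> f \<in> M \<Longrightarrow> cross e f \<Longrightarrow> f \<in> Q"
  shows "\<exists>e\<in>Q. 1 \<in> e"
proof -
  define S where "S = (\<Union>e\<in>Q. hull e)"
  have S: "S \<subseteq> {1..2 * n}"
  proof
    fix v assume "v \<in> S"
    then obtain e where "e \<in> Q" "Min e \<le> v" "v \<le> Max e"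
      unfolding S_def hull_def by auto
    then show "v \<in> {1..2 * n}"
      using edge_eq(3,4)[of e] assms(2) by auto
  qed
  have ends: "Min e \<in> S" "Max e \<in> S" if "e \<in> Q" for e
    using that edge_eq(2)[of e] assms(2) unfolding S_def hull_def by force+
  define i where "i = (LEAST i. i \<in> S)"
  obtain s where "s \<in> S"
    using ends assms(3) by blast
  then have i: "i \<in> S" "\<And>v. v \<in> S \<Longrightarrow> i \<le> v"
    unfolding i_def by (auto intro: LeastI Least_le)
  define j where "j = (LEAST j. i \<le> j \<and> Suc j \<notin> S)"
  \<comment> \<open>A witness that the \<open>LEAST\<close> defining \<open>j\<close>
    exists.\<close>
  have "i \<le> 2 * n \<and> Suc (2 * n) \<notin> S"
    using i(1) S by auto
  then have j: "i \<le> j" "Suc j \<notin> S"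
    unfolding j_def by (metis (mono_tags, lifting) LeastI)+
  have sub: "{i..j} \<subseteq> S"
  proof
    fix v assume v: "v \<in> {i..j}"
    show "v \<in> S"
    proof (cases "v = i")
      case False
      then have "i \<le> v - 1" "v - 1 < j" "Suc (v - 1) = v"
        using v by auto
      then show ?thesis
        using not_less_Least[of "v - 1" "\<lambda>j. i \<le> j \<and> Suc j \<notin> S"] unfolding j_def by auto
    qed (simp add: i)
  qed
  \<comment> \<open>A hull of an edge of \<open>Q\<close> starts no earlier than \<open>i\<close>
    and cannot step over the gap at \<open>Suc j\<close>.\<close>
  have hull_sub: "hull f \<subseteq> {i..j}" if "f \<in> Q" "w \<in> hull f" "w \<in> {i..j}" for f w
  proof -
    have "Suc j \<notin> hull f"
      using j(2) that(1) unfolding S_def by blast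
    then show ?thesis
      using i(2)[OF ends(1)[OF that(1)]] that unfolding hull_def by auto
  qed
  \<comment> \<open>An edge leaving the segment would cross an edge of \<open>Q\<close> whose hull
    covers \<open>u\<close>. By closure it would be in \<open>Q\<close>, and its own hull would then
    stay inside the segment.\<close>
  have "{u, v} \<notin> M" if u: "u \<in> {i..j}" and v: "v \<notin> {i..j}" for u v
  proof
    assume h: "{u, v} \<in> M"
    obtain e where e: "e \<in> Q" "u \<in> hull e"
      using u sub unfolding S_def by blast
    then have "v \<notin> hull e"
      using hull_sub u v by blast
    then have "cross e {u, v}"
      using cross_if_leaves_hull[of e "{u, v}" u v] e h assms(2) by auto
    then have "{u, v} \<in> Q"
      using closed e h by blast
    then show False
      using hull_sub[of "{u, v}" u] edge_subset_hull[OF h] u v by blast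
  qed
  then have "interval_of n M {i..j}"
    using sub S unfolding interval_of_def by blast
  then have "{i..j} = {1..2 * n}"
    using assms(1) j(1) unfolding indecomposable_def by fastforce
  moreover have "1 \<le> n"
    using S i(1) by auto
  ultimately have "1 \<in> S"
    using sub by auto
  then obtain e where e: "e \<in> Q" "1 \<in> hull e"
    unfolding S_def by blast
  then have "Min e = 1"
    using edge_eq(3)[of e] assms(2) unfolding hull_def by auto
  then show ?thesis
    using Min_in_edge[of e] e assms(2) by auto
qed

section \<open>Pin sequences from distance layers\<close>

text \<open>The index is one more than the distance, so that \<open>k = 1\<close> needs no special treatment.\<close>

primrec cross_ball :: "nat set \<Rightarrow> nat \<Rightarrow> nat set set" where
  "cross_ball e0 0 = {}"
| "cross_ball e0 (Suc i) = insert e0 {f \<in> M. \<exists>e\<in>cross_ball e0 i. cross e f}"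

lemma cross_ball_Suc: "cross_ball e0 i \<subseteq> cross_ball e0 (Suc i)"
proof (induction i)
  case (Suc i)
  then show ?case
    unfolding cross_ball.simps(2)[of e0 i] cross_ball.simps(2)[of e0 "Suc i"] by blast
qed simp

lemma cross_ball_mono: "i \<le> j \<Longrightarrow> cross_ball e0 i \<subseteq> cross_ball e0 j"
  using cross_ball_Suc by (rule lift_Suc_mono_le)

lemma cross_ball_subset: "e0 \<in> M \<Longrightarrow> cross_ball e0 i \<subseteq> M"
  by (induction i) auto

lemma card_cross_ball:
  assumes "e0 \<in> M" and deg: "\<And>e. e \<in> M \<Longrightarrow> card {f \<in> M. cross e f} \<le> d"
  shows "card (cross_ball e0 i) \<le> (Suc d) ^ i"
proof (induction i)
  case (Suc i)
  let ?B = "cross_ball e0 i"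
  have B: "finite ?B" "?B \<subseteq> M"
    using cross_ball_subset[OF assms(1)] finite_edges finite_subset by blast+
  have "cross_ball e0 (Suc i) = insert e0 (\<Union>e\<in>?B. {f \<in> M. cross e f})"
    by auto
  then have "card (cross_ball e0 (Suc i)) \<le> Suc (card (\<Union>e\<in>?B. {f \<in> M. cross e f}))"
    using card_insert_le_m1 by (simp add: card_insert_if finite_edges B)
  also have "\<dots> \<le> Suc (\<Sum>e\<in>?B. card {f \<in> M. cross e f})"
    using card_UN_le[OF B(1)] by simp
  also have "\<dots> \<le> Suc (card ?B * d)"
    using sum_bounded_above[of ?B "\<lambda>e. card {f \<in> M. cross e f}" d] deg B(2) by auto
  also have "\<dots> \<le> Suc ((Suc d) ^ i * d)"
    using Suc.IH by simp
  \<comment> \<open>The slack \<open>(Suc d) ^ i\<close> is at least 1 and absorbs the extra edge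
    \<open>e0\<close>.\<close>
  also have "\<dots> \<le> (Suc d) ^ Suc i"
    by (simp add: algebra_simps)
  finally show ?case .
qed simp

text \<open>An edge \<open>f\<close> with just one endpoint in the segment would cross some edge of
  \<open>P\<close> and pull it into the next ball. With both endpoints inside, a neighbour of
  \<open>f\<close> one step closer to \<open>e0\<close> would also have an endpoint inside, against
  the induction hypothesis. The descent ends at \<open>e0\<close>, whose vertex 1 lies in a hull
  only if that hull belongs to \<open>e0\<close> itself.\<close>

lemma cross_ball_disjoint_hulls:
  assumes "e0 \<in> M" "1 \<in> e0" "P \<subseteq> M" and hulls: "(\<Union>e\<in>P. hull e) = {a..b}"
  shows "P \<inter> cross_ball e0 (Suc j) = {} \<Longrightarrow> f \<in> cross_ball e0 j \<Longrightarrow> f \<inter> {a..b} = {}"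
proof (induction j arbitrary: f)
  case (Suc j)
  have f: "f \<in> M"
    using Suc.prems(2) cross_ball_subset[OF assms(1)] by blast
  have all_in: "f \<subseteq> {a..b}" if x: "x \<in> f" "x \<in> {a..b}" for x
  proof
    fix y assume "y \<in> f"
    obtain p where p: "p \<in> P" "x \<in> hull p"
      using x(2) hulls by blast
    show "y \<in> {a..b}"
    proof (rule ccontr)
      assume "y \<notin> {a..b}"
      then have "cross p f"
        using cross_if_leaves_hull[of p f x y] p x(1) f \<open>y \<in> f\<close> assms(3) hulls by blast
      then have "p \<in> cross_ball e0 (Suc (Suc j))"
        using Suc.prems(2) p(1) assms(3) cross_sym cross_ball.simps(2)[of e0 "Suc j"] by blast
      then show False
        using Suc.prems(1) p(1) by blast
    qed
  qed
  have disj: "P \<inter> cross_ball e0 (Suc j) = {}"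
    using Suc.prems(1) cross_ball_Suc by blast
  consider "f = e0" | g where "g \<in> cross_ball e0 j" "cross g f"
    using Suc.prems(2) by auto
  then show ?case
  proof cases
    case 1
    have "1 \<notin> {a..b}"
    proof
      assume "1 \<in> {a..b}"
      then obtain p where p: "p \<in> P" "1 \<in> hull p"
        using hulls by blast
      then have "1 \<in> p"
        using edge_eq(3)[of p] Min_in_edge[of p] assms(3) unfolding hull_def
        by (metis atLeastAtMost_iff le_antisym subsetD)
      then have "p = e0"
        using edge_unique p(1) assms by blast
      then show False
        using disj p(1) by simp
    qed
    then show ?thesis
      using all_in 1 assms(2) by blast
  next
    case 2
    have g: "g \<in> M" "g \<inter> {a..b} = {}"
      using 2 cross_ball_subset[OF assms(1)] Suc.IH[OF disj] by blast+
    have "hull f \<subseteq> {a..b}" if "f \<subseteq> {a..b}"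
    proof -
      have "Min f \<in> {a..b}" "Max f \<in> {a..b}"
        using that Min_in_edge[OF f] Max_in_edge[OF f] by blast+
      then show ?thesis
        unfolding hull_def by simp
    qed
    moreover obtain v where "v \<in> g" "v \<in> hull f"
      using cross_ex1_hull[OF f g(1)] cross_sym[OF 2(2)] by blast
    ultimately show ?thesis
      using all_in g(2) by blast
  qed
qed simp

text \<open>A shortest path from \<open>e\<close> to \<open>e0\<close>, built from the far end. The
  neighbour through which \<open>e\<close> enters a ball cannot belong to an earlier ball, or
  \<open>e\<close> would have entered sooner.\<close>

lemma cross_ball_path:
  "e \<in> cross_ball e0 (Suc m) - cross_ball e0 m \<Longrightarrow>
   \<exists>ps. length ps = Suc m \<and> ps ! 0 = e \<and>
     (\<forall>i\<le>m. ps ! i \<in> cross_ball e0 (Suc m - i) - cross_ball e0 (m - i)) \<and>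
     (\<forall>i<m. cross (ps ! i) (ps ! Suc i))"
proof (induction m arbitrary: e)
  case 0
  then show ?case
    by (intro exI[of _ "[e]"]) simp
next
  case (Suc m)
  have "e \<noteq> e0"
    using Suc.prems by auto
  then obtain g where g: "g \<in> cross_ball e0 (Suc m)" "cross g e" "e \<in> M"
    using Suc.prems cross_ball.simps(2)[of e0 "Suc m"] by blast
  then have "g \<notin> cross_ball e0 m"
    using Suc.prems by auto
  then obtain ps where ps: "length ps = Suc m" "ps ! 0 = g"
      "\<And>i. i \<le> m \<Longrightarrow> ps ! i \<in> cross_ball e0 (Suc m - i) - cross_ball e0 (m - i)"
      "\<And>i. i < m \<Longrightarrow> cross (ps ! i) (ps ! Suc i)"
    using Suc.IH[of g] g(1) by blast
  have "(e # ps) ! i \<in> cross_ball e0 (Suc (Suc m) - i) - cross_ball e0 (Suc m - i)" if "i \<le> Suc m" for i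
    using that Suc.prems ps(3)[of "i - 1"] by (cases i) (simp_all del: cross_ball.simps)
  moreover have "cross ((e # ps) ! i) ((e # ps) ! Suc i)" if "i < Suc m" for i
    using that ps(2,4) g(2) cross_sym by (cases i) simp_all
  ultimately show ?case
    using ps(1) by (intro exI[of _ "e # ps"]) simp
qed

text \<open>Consecutive edges cross, so each new hull overlaps the segment covered so far and leaves
  no gap.\<close>

lemma Union_hull_path:
  assumes "set ps \<subseteq> M" "\<And>i. Suc i < length ps \<Longrightarrow> cross (ps ! i) (ps ! Suc i)"
  shows "i \<le> length ps \<Longrightarrow> \<exists>a b. (\<Union>e\<in>set (take i ps). hull e) = {a..b}"
proof (induction i)
  case 0
  show ?case
    by (intro exI[of _ 1] exI[of _ 0]) simp
next
  case (Suc i)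
  then obtain a b where ab: "(\<Union>e\<in>set (take i ps). hull e) = {a..b}"
    by auto
  have take: "(\<Union>e\<in>set (take (Suc i) ps). hull e) = {a..b} \<union> hull (ps ! i)"
    using Suc.prems ab by (simp add: take_Suc_conv_app_nth Un_commute)
  show ?case
  proof (cases i)
    case 0
    then show ?thesis
      using take ab unfolding hull_def by auto
  next
    case (Suc l)
    have cr: "cross (ps ! l) (ps ! i)"
      using assms(2)[of l] Suc Suc.prems by simp
    have "ps ! l \<in> M"
      using Suc Suc.prems assms(1) by auto
    have "ps ! l \<in> set (take i ps)"
      using Suc Suc.prems by (simp add: take_Suc_conv_app_nth)
    then have "hull (ps ! l) \<subseteq> {a..b}"
      using ab by blast
    then have "{a..b} \<union> hull (ps ! i) = {min a (Min (ps ! i))..max b (Max (ps ! i))}"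
      using cr edge_eq(2)[OF \<open>ps ! l \<in> M\<close>] unfolding hull_def cross_def by auto
    then show ?thesis
      using take by auto
  qed
qed

text \<open>Each pin crosses its predecessor, so exactly one of its endpoints is in that hull, and
  it avoids the hulls of all earlier pins. It therefore splits the shadow of all preceding pins, but
  not the shadow without the last of them.\<close>

lemma proper_pin_sequence_if_layer:
  assumes "e0 \<in> M" "1 \<in> e0" "e \<in> cross_ball e0 (Suc m) - cross_ball e0 m"
  obtains ps where "length ps = Suc m" "set ps \<subseteq> M" "distinct ps" "proper_pin_sequence ps"
proof -
  obtain ps where len: "length ps = Suc m"
    and layer: "\<And>i. i \<le> m \<Longrightarrow> ps ! i \<in> cross_ball e0 (Suc m - i) - cross_ball e0 (m - i)"
    and cr: "\<And>i. i < m \<Longrightarrow> cross (ps ! i) (ps ! Suc i)"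
    using cross_ball_path[OF assms(3)] by blast
  have ps_M: "ps ! i \<in> M" if "i \<le> m" for i
    using layer[OF that] cross_ball_subset[OF assms(1)] by blast
  then have sub: "set ps \<subseteq> M"
    using len by (auto simp: in_set_conv_nth less_Suc_eq_le)
  \<comment> \<open>The two edges are in different layers.\<close>
  have "ps ! i \<noteq> ps ! l" if "i < l" "l \<le> m" for i l
  proof -
    have "Suc m - l \<le> m - i"
      using that by linarith
    then have "ps ! l \<in> cross_ball e0 (m - i)"
      using layer[of l] that(2) cross_ball_mono by blast
    moreover have "ps ! i \<notin> cross_ball e0 (m - i)"
      using layer[of i] that by simp
    ultimately show ?thesis
      by metis
  qed
  then have "distinct ps"
    using len unfolding distinct_conv_nth by (metis less_Suc_eq_le linorder_neqE_nat)
  have disj: "set (take i ps) \<inter> cross_ball e0 (Suc m - i) = {}" if "i \<le> m" for i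
  proof -
    have "ps ! l \<notin> cross_ball e0 (Suc m - i)" if "l < i" for l
    proof -
      have "l \<le> m" "Suc m - i \<le> m - l"
        using that \<open>i \<le> m\<close> by linarith+
      then show ?thesis
        using layer[of l] cross_ball_mono by blast
    qed
    then show ?thesis
      by (auto simp: in_set_conv_nth)
  qed
  have cr': "cross (ps ! i) (ps ! Suc i)" if "Suc i < length ps" for i
    using cr that len by simp
  have shadow: "shadow (set (take i ps)) = (\<Union>e\<in>set (take i ps). hull e)" if "i \<le> m" for i
    using Union_hull_path[OF sub cr', of i] shadow_eq_Union_hull[of "set (take i ps)"] that len
      set_take_subset[of i ps] sub by fastforce
  \<comment> \<open>The prefix stops before \<open>ps ! i\<close>, the immediate predecessor. Its
    edges lie outside the ball of index \<open>Suc (m - i)\<close>, one larger than the ball holding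
    \<open>ps ! Suc i\<close>, as the disjointness lemma requires.\<close>
  have outside: "ps ! Suc i \<inter> (\<Union>e\<in>set (take i ps). hull e) = {}" if "Suc i \<le> m" for i
  proof -
    obtain a b where ab: "(\<Union>e\<in>set (take i ps). hull e) = {a..b}"
      using Union_hull_path[OF sub cr', of i] \<open>Suc i \<le> m\<close> len by auto
    have "Suc m - i = Suc (m - i)"
      using that by simp
    then have "set (take i ps) \<inter> cross_ball e0 (Suc (m - i)) = {}"
      using disj[of i] that by (metis Suc_leD)
    moreover have "ps ! Suc i \<in> cross_ball e0 (m - i)"
      using layer[OF that] by simp
    ultimately show ?thesis
      using cross_ball_disjoint_hulls[OF assms(1,2) _ ab] set_take_subset[of i ps] sub ab by blast
  qed
  have "splits (ps ! i) (shadow (set (take i ps)))" if i: "1 \<le> i" "i < length ps" for i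
  proof -
    obtain l where l: "i = Suc l" "l < m" "Suc l \<le> m"
      using i len by (cases i) auto
    have "shadow (set (take i ps)) = hull (ps ! l) \<union> (\<Union>e\<in>set (take l ps). hull e)"
      using shadow[of i] l len by (simp add: take_Suc_conv_app_nth)
    moreover have "\<exists>!v. v \<in> ps ! i \<and> v \<in> hull (ps ! l)"
      using cross_ex1_hull[of "ps ! l" "ps ! i"] ps_M cr l by simp
    ultimately show ?thesis
      using outside[OF l(3)] l(1) unfolding splits_def by blast
  qed
  moreover have "\<not> splits (ps ! i) (shadow (set (take (i - 1) ps)))" if i: "2 \<le> i" "i < length ps" for i
  proof -
    obtain l where l: "i = Suc l" "l \<le> m" "Suc l \<le> m"
      using i len by (cases i) auto
    then show ?thesis
      using outside[OF l(3)] shadow[of l] unfolding splits_def by auto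
  qed
  ultimately have "proper_pin_sequence ps"
    unfolding proper_pin_sequence_def pin_sequence_def by blast
  then show thesis
    using that len sub \<open>distinct ps\<close> by blast
qed

text \<open>If no layer were added, the complement of the ball would be closed under crossing.
  Indecomposability then puts an edge through vertex 1 in it, but that edge is
  \<open>e0\<close>.\<close>

lemma next_layer_nonempty:
  assumes "indecomposable n M" "e0 \<in> M" "1 \<in> e0" "\<not> M \<subseteq> cross_ball e0 m"
  obtains e where "e \<in> cross_ball e0 (Suc m) - cross_ball e0 m"
proof -
  have False if eq: "cross_ball e0 (Suc m) \<subseteq> cross_ball e0 m"
  proof -
    have "f \<in> M - cross_ball e0 m" if "e \<in> M - cross_ball e0 m" "f \<in> M" "cross e f" for e f
      using that eq cross_sym by auto
    then obtain e where "e \<in> M - cross_ball e0 m" "1 \<in> e"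
      using indecomposable_cross_closed[OF assms(1), of "M - cross_ball e0 m"] assms(4) by blast
    then show False
      using edge_unique assms(2,3) eq by auto
  qed
  then show thesis
    using that by blast
qed

end

section \<open>Counting edges by layers\<close>

theorem theorem1p1:
  fixes k n :: nat and M :: "nat set set"
  assumes "k > 0"
    and "matching n M"
    and "indecomposable n M"
    and "card M \<ge> (2 * k) ^ (2 * k)"
  shows "\<exists>N. matching k N \<and>
           (broken_nesting k N \<or> N = interleaving k \<or> proper_pin_sequence_matching N) \<and>
           contains M N"
proof -
  interpret matching_graph n M
    using assms(2) by unfold_locales
  show ?thesis
  proof (cases "has_nesting_or_interleaving k")
    case True
    then show ?thesis
      unfolding has_nesting_or_interleaving_def by blast
  next
    case False
    have "0 < card M"
      using assms(1,4) less_le_trans[of 0 "(2 * k) ^ (2 * k)" "card M"] by simp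
    then obtain e where "e \<in> M"
      by (metis card.empty all_not_in_conv less_irrefl)
    then have "1 \<in> {1..2 * n}"
      using edge_eq(2-4)[of e] by simp
    then obtain e0 where e0: "e0 \<in> M" "1 \<in> e0"
      using assms(2) unfolding matching_def by blast
    \<comment> \<open>With maximum degree \<open>2 * (k - 1)\<^sup>2\<close>, this bounds the growth
      factor of the balls by \<open>(2 * k)\<^sup>2\<close>; \<open>k - 1\<close> steps then stay
      below \<open>(2 * k) ^ (2 * k)\<close>.\<close>
    have "Suc (2 * (k - 1)\<^sup>2) \<le> (2 * k)\<^sup>2"
      using assms(1) by (cases k) (auto simp: power2_eq_square)
    then have "Suc (2 * (k - 1)\<^sup>2) ^ (k - 1) \<le> ((2 * k)\<^sup>2) ^ (k - 1)"
      by (rule power_mono) simp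
    also have "\<dots> = (2 * k) ^ (2 * (k - 1))"
      by (simp add: power_mult)
    also have "\<dots> < (2 * k) ^ (2 * k)"
      using assms(1) by (intro power_strict_increasing) auto
    finally have "card (cross_ball e0 (k - 1)) < card M"
      using card_cross_ball[OF e0(1) degree_bound[OF _ assms(1) False], of "k - 1"] assms(4) by simp
    then have "\<not> M \<subseteq> cross_ball e0 (k - 1)"
      using cross_ball_subset[OF e0(1)] by (metis less_irrefl subset_antisym)
    \<comment> \<open>The edge \<open>f\<close> is at distance \<open>k - 1\<close> from
      \<open>e0\<close>, so the path between them has exactly \<open>k\<close> edges.\<close>
    then obtain f where "f \<in> cross_ball e0 (Suc (k - 1)) - cross_ball e0 (k - 1)"
      using next_layer_nonempty[OF assms(3) e0] by blast
    then obtain ps where ps: "length ps = Suc (k - 1)" "set ps \<subseteq> M" "distinct ps" "proper_pin_sequence ps"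
      using proper_pin_sequence_if_layer[OF e0] by blast
    have "card (set ps) = k"
      using ps(1,3) assms(1) by (simp add: distinct_card)
    then have "matching k (relabel (set ps))"
      using matching_relabel[OF ps(2)] card_Union_edges[OF ps(2)] by simp
    moreover have "finite (\<Union>(set ps))"
      using ps(2) finite_edge(1) by blast
    ultimately show ?thesis
      using proper_pin_sequence_matching_relabel[OF _ ps(3,4)] contains_relabel[OF ps(2)] by blast
  qed
qed

end
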